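(* Let $M^{>0}=\{(x^1,x^2,x^3,x^4,x^5,x^6)\in\mathbb R^6 \mid x^2>0\}$, let $f:\mathbb R^{>0}\to\mathbb R^{>0}$, $f(x^2)=x^2$ (the identity function of the coordinate $x^2$), and let $$\omega^f=dx^{135}-dx^{146}-dx^{236}+f(x^2)\,dx^{245}.$$ Then $(M^{>0},\omega^f)$ is multisymplectic and of constant linear type. Furthermore, it is non-flat, and its group of multisymplectic diffeomorphisms acts 1-transitively but not 2-transitively on $M^{>0}$.
   Context: Here $x^1,\dots,x^6$ are coordinates (upper indices, not powers) and $dx^{ijk}=dx^i\wedge dx^j\wedge dx^k$. A manifold $M$ with a closed $(k+1)$-form $\omega$, $k\ge1$, is multisymplectic if $T_pM\to\Lambda^kT_p^*M$, $v\mapsto\iota_v\omega_p$, is injective for all $p$. Constant linear type: for all $p,q\in M$ there is a linear isomorphism $L:T_pM\to T_qM$ with $L^*\omega_q=\omega_p$. Flat: $(M,\omega)$ is flat if for every $p\in M$ there is a chart $\phi:U\to T_pM$ on an open neighbourhood $U$ of $p$ (a diffeomorphism onto an open subset) with $\phi(p)=0$ and $\phi^*\omega_p=\omega|_U$, where $\omega_p$ is regarded as a constant-coefficient form on $T_pM$; non-flat means not flat. The group of multisymplectic diffeomorphisms is the group of all diffeomorphisms $\varphi:M\to M$ with $\varphi^*\omega=\omega$. A group action on a set $X$ is $k$-transitive if for any two $k$-tuples $(p_1,\dots,p_k)$ and $(q_1,\dots,q_k)$ of pairwise distinct elements of $X$ there is a group element $g$ with $g(p_i)=q_i$ for all $i$.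 *)

theory Defs
  imports "HOL-Analysis.Analysis"
begin

text \<open>
  The manifolds considered are open subsets of a Euclidean space \<open>'a\<close>; every tangent space is
  canonically \<open>'a\<close> itself.  All derivatives below are taken at points of open sets, so that
  \<open>frechet_derivative _ (at x)\<close> does not depend on values outside the set.
\<close>

section \<open>Smooth maps and diffeomorphisms\<close>

text \<open>In finite dimensions, continuity of all iterated directional derivatives is the usual \<open>C^n\<close>
  condition.\<close>

primrec Ck_on :: "nat \<Rightarrow> 'a::euclidean_space set \<Rightarrow> ('a \<Rightarrow> 'b::real_normed_vector) \<Rightarrow> bool" where
  "Ck_on 0 S f \<longleftrightarrow> continuous_on S f"
| "Ck_on (Suc n) S f \<longleftrightarrow>
     (\<forall>x\<in>S. f differentiable (at x)) \<and> (\<forall>v. Ck_on n S (\<lambda>x. frechet_derivative f (at x) v))"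

definition smooth_on :: "'a::euclidean_space set \<Rightarrow> ('a \<Rightarrow> 'b::real_normed_vector) \<Rightarrow> bool" where
  "smooth_on S f \<longleftrightarrow> (\<forall>n. Ck_on n S f)"

definition diffeomorphism :: "'a::euclidean_space set \<Rightarrow> 'b::euclidean_space set \<Rightarrow> ('a \<Rightarrow> 'b) \<Rightarrow> bool" where
  "diffeomorphism U V \<phi> \<longleftrightarrow>
     open U \<and> open V \<and> bij_betw \<phi> U V \<and> smooth_on U \<phi> \<and> smooth_on V (inv_into U \<phi>)"

section \<open>Differential forms\<close>

text \<open>An \<open>m\<close>-covector is a function on lists of vectors, of which only the values on lists of
  length \<open>m\<close> are relevant.\<close>

type_synonym 'a covector = "'a list \<Rightarrow> real"

definition form_eq :: "nat \<Rightarrow> 'a covector \<Rightarrow> 'a covector \<Rightarrow> bool" where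
  "form_eq m \<alpha> \<beta> \<longleftrightarrow> (\<forall>vs. length vs = m \<longrightarrow> \<alpha> vs = \<beta> vs)"

definition alternating_form :: "nat \<Rightarrow> 'a::real_vector covector \<Rightarrow> bool" where
  "alternating_form m \<alpha> \<longleftrightarrow>
     (\<forall>vs. length vs = m \<longrightarrow>
        (\<forall>i<m. linear (\<lambda>v. \<alpha> (vs[i := v]))) \<and> (\<not> distinct vs \<longrightarrow> \<alpha> vs = 0))"

definition differential_form :: "nat \<Rightarrow> 'a::euclidean_space set \<Rightarrow> ('a \<Rightarrow> 'a covector) \<Rightarrow> bool" where
  "differential_form m S \<omega> \<longleftrightarrow>
     (\<forall>p\<in>S. alternating_form m (\<omega> p)) \<and> (\<forall>vs. length vs = m \<longrightarrow> smooth_on S (\<lambda>p. \<omega> p vs))"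

text \<open>The invariant formula for the exterior derivative, evaluated on constant vector fields (whose
  Lie brackets vanish).\<close>

definition ext_deriv :: "('a::euclidean_space \<Rightarrow> 'a covector) \<Rightarrow> 'a \<Rightarrow> 'a covector" where
  "ext_deriv \<omega> p vs =
     (\<Sum>i<length vs. (-1) ^ i *
        frechet_derivative (\<lambda>x. \<omega> x (take i vs @ drop (Suc i) vs)) (at p) (vs ! i))"

definition closed_form :: "nat \<Rightarrow> 'a::euclidean_space set \<Rightarrow> ('a \<Rightarrow> 'a covector) \<Rightarrow> bool" where
  "closed_form m S \<omega> \<longleftrightarrow> (\<forall>p\<in>S. form_eq (Suc m) (ext_deriv \<omega> p) (\<lambda>_. 0))"

definition contract :: "'a \<Rightarrow> 'a covector \<Rightarrow> 'a covector" where
  "contract v \<alpha> = (\<lambda>vs. \<alpha> (v # vs))"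

definition linear_pullback :: "('a \<Rightarrow> 'b) \<Rightarrow> 'b covector \<Rightarrow> 'a covector" where
  "linear_pullback L \<alpha> = (\<lambda>vs. \<alpha> (map L vs))"

definition pullback :: "('a::euclidean_space \<Rightarrow> 'b::euclidean_space) \<Rightarrow> ('b \<Rightarrow> 'b covector) \<Rightarrow> 'a \<Rightarrow> 'a covector" where
  "pullback \<phi> \<omega> x = linear_pullback (frechet_derivative \<phi> (at x)) (\<omega> (\<phi> x))"

section \<open>Multisymplectic structures\<close>

text \<open>Here \<open>\<omega>\<close> has degree \<open>k + 1\<close>; the restriction to lists of length \<open>k\<close> makes injectivity
  refer to equality of \<open>k\<close>-covectors.\<close>

definition multisymplectic :: "nat \<Rightarrow> 'a::euclidean_space set \<Rightarrow> ('a \<Rightarrow> 'a covector) \<Rightarrow> bool" where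
  "multisymplectic k S \<omega> \<longleftrightarrow>
     k \<ge> 1 \<and> open S \<and> differential_form (Suc k) S \<omega> \<and> closed_form (Suc k) S \<omega> \<and>
     (\<forall>p\<in>S. inj (\<lambda>v. restrict (contract v (\<omega> p)) {vs. length vs = k}))"

definition constant_linear_type :: "nat \<Rightarrow> 'a::euclidean_space set \<Rightarrow> ('a \<Rightarrow> 'a covector) \<Rightarrow> bool" where
  "constant_linear_type m S \<omega> \<longleftrightarrow>
     (\<forall>p\<in>S. \<forall>q\<in>S. \<exists>L. linear L \<and> bij L \<and> form_eq m (linear_pullback L (\<omega> q)) (\<omega> p))"

definition flat :: "nat \<Rightarrow> 'a::euclidean_space set \<Rightarrow> ('a \<Rightarrow> 'a covector) \<Rightarrow> bool" where
  "flat m S \<omega> \<longleftrightarrow>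
     (\<forall>p\<in>S. \<exists>U V \<phi>. open U \<and> p \<in> U \<and> U \<subseteq> S \<and> diffeomorphism U (V :: 'a set) \<phi> \<and> \<phi> p = 0 \<and>
        (\<forall>x\<in>U. form_eq m (pullback \<phi> (\<lambda>_. \<omega> p) x) (\<omega> x)))"

text \<open>Taking extensional functions identifies each diffeomorphism of \<open>S\<close> with exactly one element;
  the group operation is \<open>compose S\<close>.\<close>

definition multisymplectic_diffeos :: "nat \<Rightarrow> 'a::euclidean_space set \<Rightarrow> ('a \<Rightarrow> 'a covector) \<Rightarrow> ('a \<Rightarrow> 'a) set" where
  "multisymplectic_diffeos m S \<omega> =
     {\<phi> \<in> extensional S. diffeomorphism S S \<phi> \<and> (\<forall>x\<in>S. form_eq m (pullback \<phi> \<omega> x) (\<omega> x))}"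

definition k_transitive :: "nat \<Rightarrow> 'g set \<Rightarrow> ('g \<Rightarrow> 'x \<Rightarrow> 'x) \<Rightarrow> 'x set \<Rightarrow> bool" where
  "k_transitive k G act X \<longleftrightarrow>
     (\<forall>ps qs. length ps = k \<and> distinct ps \<and> set ps \<subseteq> X \<and> length qs = k \<and> distinct qs \<and> set qs \<subseteq> X \<longrightarrow>
        (\<exists>g\<in>G. \<forall>i<k. act g (ps ! i) = qs ! i))"

section \<open>The forms on the half space\<close>

text \<open>\<open>dx [i, j, \<dots>]\<close> is the wedge product of the coordinate covectors with these indices, in the
  determinant convention \<open>(\<alpha>\<^sub>1 \<and> \<dots> \<and> \<alpha>\<^sub>m)(v\<^sub>1, \<dots>, v\<^sub>m) = det (\<alpha>\<^sub>i (v\<^sub>j))\<close>.\<close>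

definition dx :: "'n::finite list \<Rightarrow> (real ^ 'n) covector" where
  "dx is vs = (\<Sum>\<pi> | \<pi> permutes {..<length is}.
     of_int (sign \<pi>) * (\<Prod>i<length is. (vs ! \<pi> i) $ (is ! i)))"

text \<open>In the index type \<open>6\<close> the numerals \<open>1, \<dots>, 6\<close> denote its six distinct elements
  (\<open>6\<close> being the element also written \<open>0\<close>).\<close>

definition M_pos :: "(real ^ 6) set" where
  "M_pos = {x. x $ 2 > 0}"

definition omega :: "(real \<Rightarrow> real) \<Rightarrow> real ^ 6 \<Rightarrow> (real ^ 6) covector" where
  "omega f x vs =
     dx [1, 3, 5] vs - dx [1, 4, 6] vs - dx [2, 3, 6] vs + f (x $ 2) * dx [2, 4, 5] vs"

end

theory Submission
  imports Defs
begin

text \<open>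
  With \<open>s = sqrt x\<^sup>2\<close> and
  \<open>\<Omega>\<^sub>s = (dx\<^sup>1 - s dx\<^sup>2) \<and> (dx\<^sup>3 - s dx\<^sup>4) \<and> (dx\<^sup>5 + dx\<^sup>6 / s)\<close> one has
  \<open>\<omega> = (\<Omega>\<^sub>s + \<Omega>\<^sub>-\<^sub>s) / 2\<close>.  This decomposition is unique up to order, so every isomorphism of \<open>\<omega>\<close>
  maps the form \<open>\<eta> = (\<Omega>\<^sub>s - \<Omega>\<^sub>-\<^sub>s) / 2\<close> to \<open>\<plusminus>\<eta>\<close>, with a locally constant sign.  Hence \<open>d\<eta>\<close> is
  invariant up to sign.  It equals \<open>(1 / 2s) dx\<^sup>1\<^sup>2 \<and> (s\<^sup>-\<^sup>2 dx\<^sup>3\<^sup>6 + dx\<^sup>4\<^sup>5)\<close>: it does not vanish, so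
  \<open>\<omega>\<close> is not flat, and it determines the distribution \<open>dx\<^sup>1 = dx\<^sup>2 = 0\<close>, so every multisymplectic
  diffeomorphism permutes the leaves \<open>(x\<^sup>1, x\<^sup>2) = const\<close> and the action is not 2-transitive.  Affine
  maps with weighted diagonal linear part give transitivity and constant linear type.
\<close>

section \<open>Linear algebra of the 3-form\<close>

lemma exhaust_6: "x = 1 \<or> x = 2 \<or> x = 3 \<or> x = 4 \<or> x = 5 \<or> x = (6::6)"
proof (induct x)
  case (of_int z)
  then have "z = 0 \<or> z = 1 \<or> z = 2 \<or> z = 3 \<or> z = 4 \<or> z = 5" by fastforce
  then show ?case by auto
qed

lemma forall_6: "(\<forall>i::6. P i) \<longleftrightarrow> P 1 \<and> P 2 \<and> P 3 \<and> P 4 \<and> P 5 \<and> P 6"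
  by (metis exhaust_6)

lemma list_length_3E:
  assumes "length vs = 3"
  obtains u v w where "vs = [u, v, w]"
  using assms by (auto simp: length_Suc_conv eval_nat_numeral)

text \<open>Cofactor expansion along \<open>u\<close>; inserting one index at a time enumerates the
  six permutations.\<close>

lemma dx_3: "dx [i, j, k] [u, v, w] =
   u$i * (v$j * w$k - v$k * w$j) - u$j * (v$i * w$k - v$k * w$i) + u$k * (v$i * w$j - v$j * w$i)"
proof -
  have f: "finite {Suc 0, 2}" "0 \<notin> {Suc 0, 2}" "finite {2::nat}" "Suc 0 \<notin> {2}" by auto
  have *: "{..<length [i,j,k]} = {0, Suc 0, 2}" by auto
  show ?thesis
    unfolding dx_def * sum_over_permutations_insert[OF f(1,2)] sum_over_permutations_insert[OF f(3,4)]
      permutes_sing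
    by (simp add: sign_swap_id permutation_swap_id sign_compose permutation_compose
        sign_id transpose_def algebra_simps)
qed

section \<open>Splitting the 3-form into two decomposable summands\<close>

definition omega_split :: "real \<Rightarrow> (real ^ 6) covector" where
  "omega_split s vs = dx [1, 3, 5] vs - dx [1, 4, 6] vs - dx [2, 3, 6] vs + s\<^sup>2 * dx [2, 4, 5] vs"

definition eta_split :: "real \<Rightarrow> (real ^ 6) covector" where
  "eta_split s vs = dx [1, 3, 6] vs / s - s * (dx [1, 4, 5] vs + dx [2, 3, 5] vs - dx [2, 4, 6] vs)"

text \<open>The three factors of \<open>\<Omega>\<^sub>s\<close>.\<close>

definition split_proj :: "real \<Rightarrow> real ^ 6 \<Rightarrow> real ^ 3" where
  "split_proj s v = vector [v $ 1 - s * v $ 2, v $ 3 - s * v $ 4, v $ 5 + v $ 6 / s]"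

lemma linear_split_proj: "linear (split_proj s)"
  by (rule linearI) (auto simp: split_proj_def vec_eq_iff forall_3 algebra_simps add_divide_distrib)

lemma omega_eq_split: "x $ 2 \<ge> 0 \<Longrightarrow> f (x $ 2) = x $ 2 \<Longrightarrow> omega f x = omega_split (sqrt (x $ 2))"
  by (auto simp: omega_def omega_split_def fun_eq_iff)

unbundle cross3_syntax

lemma omega_split_eq_triple:
  assumes "s \<noteq> 0"
  shows "omega_split s [u, v, w] =
    (split_proj s u \<bullet> (split_proj s v \<times> split_proj s w)
      + split_proj (-s) u \<bullet> (split_proj (-s) v \<times> split_proj (-s) w)) / 2"
  using assms by (simp add: omega_split_def dx_3 split_proj_def cross3_simps power2_eq_square divide_simps)

lemma eta_split_eq_triple:
  assumes "s \<noteq> 0"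
  shows "eta_split s [u, v, w] =
    (split_proj s u \<bullet> (split_proj s v \<times> split_proj s w)
      - split_proj (-s) u \<bullet> (split_proj (-s) v \<times> split_proj (-s) w)) / 2"
  using assms by (simp add: eta_split_def dx_3 split_proj_def cross3_simps power2_eq_square divide_simps)

text \<open>Half sums and half differences of \<open>a\<close> and \<open>b\<close> invert the two
  projections jointly; hence the space is the direct sum of their kernels.\<close>

lemma split_proj_surj:
  assumes "s \<noteq> 0"
  obtains v where "split_proj s v = a" "split_proj (-s) v = b"
proof
  let ?v = "(\<chi> i. if i = 1 then (a$1 + b$1) / 2 else if i = 2 then (b$1 - a$1) / (2 * s)
     else if i = 3 then (a$2 + b$2) / 2 else if i = 4 then (b$2 - a$2) / (2 * s)
     else if i = 5 then (a$3 + b$3) / 2 else s * (a$3 - b$3) / 2) :: real ^ 6"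
  show "split_proj s ?v = a" "split_proj (-s) ?v = b"
    using assms by (simp_all add: split_proj_def vec_eq_iff forall_3 field_simps)
qed

text \<open>Each pair of test vectors isolates one coordinate of \<open>u\<close> through a monomial
  with coefficient 1 or -1. The monomial \<open>dx [2, 4, 5]\<close> is avoided, so the argument is
  uniform in \<open>s\<close>.\<close>

lemma omega_split_nondegenerate:
  assumes "\<And>v w. omega_split s [u, v, w] = 0"
  shows "u = 0"
proof -
  have "u $ 1 = 0" using assms[of "axis 3 1" "axis 5 1"] by (simp add: omega_split_def dx_3 axis_def)
  moreover have "u $ 2 = 0" using assms[of "axis 3 1" "axis 6 1"] by (simp add: omega_split_def dx_3 axis_def)
  moreover have "u $ 3 = 0" using assms[of "axis 1 1" "axis 5 1"] by (simp add: omega_split_def dx_3 axis_def)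
  moreover have "u $ 4 = 0" using assms[of "axis 1 1" "axis 6 1"] by (simp add: omega_split_def dx_3 axis_def)
  moreover have "u $ 5 = 0" using assms[of "axis 1 1" "axis 3 1"] by (simp add: omega_split_def dx_3 axis_def)
  moreover have "u $ 6 = 0" using assms[of "axis 1 1" "axis 4 1"] by (simp add: omega_split_def dx_3 axis_def)
  ultimately show ?thesis by (simp add: vec_eq_iff forall_6)
qed

section \<open>Recovering the two kernels from the Plucker relations\<close>

lemma triple_product_nonzero:
  assumes "x \<noteq> (0 :: real ^ 3)"
  obtains a b where "x \<bullet> (a \<times> b) \<noteq> 0"
proof -
  consider "x $ 1 \<noteq> 0" | "x $ 2 \<noteq> 0" | "x $ 3 \<noteq> 0"
    using assms by (auto simp: vec_eq_iff forall_3)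
  then show ?thesis
  proof cases
    case 1 then show ?thesis using that[of "axis 2 1" "axis 3 1"] by (simp add: cross_basis inner_axis)
  next
    case 2 then show ?thesis using that[of "axis 3 1" "axis 1 1"] by (simp add: cross_basis inner_axis)
  next
    case 3 then show ?thesis using that[of "axis 1 1" "axis 2 1"] by (simp add: cross_basis inner_axis)
  qed
qed

text \<open>The Plucker relations for the 2-form \<open>\<iota>\<^sub>v\<omega>\<close>, i.e. its decomposability.  They make the union of
  the kernels of \<open>split_proj s\<close> and \<open>split_proj (- s)\<close> visible to isomorphisms of \<open>\<omega>\<close>.\<close>

definition plucker :: "real \<Rightarrow> real ^ 6 \<Rightarrow> bool" where
  "plucker s v \<longleftrightarrow> (\<forall>a b c d. omega_split s [v, a, b] * omega_split s [v, c, d]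
     - omega_split s [v, a, c] * omega_split s [v, b, d]
     + omega_split s [v, a, d] * omega_split s [v, b, c] = 0)"

text \<open>The left side is half the wedge square of the 2-form sending \<open>a\<close>,
  \<open>b\<close> to \<open>x \<bullet> (a \<times> b)\<close>, hence a 4-form on a 3-dimensional
  space.\<close>

lemma plucker_triple:
  "(x \<bullet> (a \<times> b)) * (x \<bullet> (c \<times> d)) - (x \<bullet> (a \<times> c)) * (x \<bullet> (b \<times> d)) + (x \<bullet> (a \<times> d)) * (x \<bullet> (b \<times> c)) = 0"
  for x :: "real ^ 3"
  by (simp add: cross3_simps)

text \<open>Contraction with \<open>v\<close> gives half the sum of two 2-forms pulled back along
  \<open>split_proj s\<close> and \<open>split_proj (-s)\<close>. If one vanishes, the other is
  decomposable; if neither does, their wedge product is nonzero.\<close>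

lemma plucker_iff:
  assumes "s \<noteq> 0"
  shows "plucker s v \<longleftrightarrow> split_proj s v = 0 \<or> split_proj (-s) v = 0"
proof
  assume pl: "plucker s v"
  show "split_proj s v = 0 \<or> split_proj (-s) v = 0"
  proof (rule ccontr)
    assume neg: "\<not> ?thesis"
    obtain a b where ab: "split_proj s v \<bullet> (a \<times> b) \<noteq> 0" using triple_product_nonzero neg by metis
    obtain c d where cd: "split_proj (-s) v \<bullet> (c \<times> d) \<noteq> 0" using triple_product_nonzero neg by metis
    \<comment> \<open>\<open>a'\<close>, \<open>b'\<close> lie in one kernel and \<open>c'\<close>,
      \<open>d'\<close> in the other, so the mixed products vanish and the first product is a
      quarter of a product of two nonzero numbers.\<close>
    obtain a' b' c' d' where
      "split_proj s a' = a" "split_proj (-s) a' = 0"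
      "split_proj s b' = b" "split_proj (-s) b' = 0"
      "split_proj s c' = 0" "split_proj (-s) c' = c"
      "split_proj s d' = 0" "split_proj (-s) d' = d"
      using split_proj_surj[OF assms] by metis
    moreover have "omega_split s [v, a', b'] * omega_split s [v, c', d']
     - omega_split s [v, a', c'] * omega_split s [v, b', d']
     + omega_split s [v, a', d'] * omega_split s [v, b', c'] = 0"
      using pl unfolding plucker_def by blast
    ultimately show False using ab cd by (simp add: omega_split_eq_triple[OF assms])
  qed
next
  assume "split_proj s v = 0 \<or> split_proj (-s) v = 0"
  then show "plucker s v"
  proof
    assume "split_proj s v = 0"
    then show ?thesis
      using plucker_triple[of "split_proj (-s) v" "split_proj (-s) a" "split_proj (-s) b"
          "split_proj (-s) c" "split_proj (-s) d" for a b c d]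
      by (simp add: plucker_def omega_split_eq_triple[OF assms]
          add_divide_distrib[symmetric] diff_divide_distrib[symmetric])
  next
    assume "split_proj (-s) v = 0"
    then show ?thesis
      using plucker_triple[of "split_proj s v" "split_proj s a" "split_proj s b"
          "split_proj s c" "split_proj s d" for a b c d]
      by (simp add: plucker_def omega_split_eq_triple[OF assms]
          add_divide_distrib[symmetric] diff_divide_distrib[symmetric])
  qed
qed

unbundle no cross3_syntax

section \<open>Linear isomorphisms of the 3-form and their effect on
  \<open>eta_split\<close>\<close>

lemma omega_split_minus [simp]: "omega_split (-s) = omega_split s"
  by (simp add: omega_split_def fun_eq_iff)

lemma eta_split_minus: "eta_split (-s) vs = - eta_split s vs"
  by (simp add: eta_split_def)

text \<open>Nondegeneracy makes the kernel of \<open>L\<close> trivial, and an injective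
  endomorphism in finite dimension is onto.\<close>

lemma omega_split_pullback_bij:
  assumes L: "linear L" and pb: "\<And>u v w. omega_split t [L u, L v, L w] = omega_split s [u, v, w]"
  shows "bij L"
proof -
  have "u = 0" if "L u = 0" for u
  proof (rule omega_split_nondegenerate[of s])
    fix v w show "omega_split s [u, v, w] = 0"
      using pb[of u v w] that by (simp add: omega_split_def dx_3)
  qed
  then have "inj L" using L by (simp add: linear_injective_0)
  then show "bij L" using linear_injective_imp_surjective[OF L] by (simp add: bij_def)
qed

text \<open>On the \<open>q\<close> parts only the first summand of \<open>omega_split\<close>
  survives, on the \<open>p\<close> parts only the second. So \<open>eta_split\<close> is
  \<open>omega_split\<close> of the \<open>q\<close> parts minus \<open>omega_split\<close> of the
  \<open>p\<close> parts, and \<open>L\<close> respects all of these data.\<close>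

lemma eta_split_pullback_aligned:
  assumes L: "linear L" and pb: "\<And>u v w. omega_split t [L u, L v, L w] = omega_split s [u, v, w]"
    and s: "s \<noteq> 0" and t: "t \<noteq> 0"
    and P: "\<And>v. split_proj s v = 0 \<Longrightarrow> split_proj t (L v) = 0"
    and Q: "\<And>v. split_proj (-s) v = 0 \<Longrightarrow> split_proj (-t) (L v) = 0"
  shows "eta_split t [L u, L v, L w] = eta_split s [u, v, w]"
proof -
  have "\<exists>p q. v = p + q \<and> split_proj s p = 0 \<and> split_proj (-s) q = 0" for v
  proof -
    obtain p where p: "split_proj s p = 0" "split_proj (-s) p = split_proj (-s) v"
      using split_proj_surj[OF s] by metis
    then show ?thesis
      by (intro exI[of _ p] exI[of _ "v - p"]) (simp add: linear_diff[OF linear_split_proj])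
  qed
  then obtain p q where pq: "\<And>v. v = p v + q v" "\<And>v. split_proj s (p v) = 0" "\<And>v. split_proj (-s) (q v) = 0"
    by metis
  have 1: "split_proj r v = split_proj r (p v) + split_proj r (q v)" for r v
    by (subst pq(1)) (rule linear_add[OF linear_split_proj])
  have 2: "split_proj r (L v) = split_proj r (L (p v)) + split_proj r (L (q v))" for r v
    by (subst pq(1)) (simp add: linear_add[OF linear_split_proj] linear_add[OF L])
  have "eta_split s [u, v, w] = omega_split s [q u, q v, q w] - omega_split s [p u, p v, p w]"
    by (simp add: eta_split_eq_triple omega_split_eq_triple s 1[of _ u] 1[of _ v] 1[of _ w] pq diff_divide_distrib)
  moreover have "eta_split t [L u, L v, L w] = omega_split t [L (q u), L (q v), L (q w)] - omega_split t [L (p u), L (p v), L (p w)]"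
    by (simp add: eta_split_eq_triple omega_split_eq_triple t 2[of _ u] 2[of _ v] 2[of _ w] pq P Q diff_divide_distrib)
  ultimately show ?thesis by (simp add: pb)
qed

text \<open>The Plucker condition is invariant, so \<open>L\<close> maps the union of the two
  kernels into the union of the target kernels. Hence it either matches kernels of equal sign or
  swaps them.\<close>

lemma eta_split_pullback:
  assumes L: "linear L" and pb: "\<And>u v w. omega_split t [L u, L v, L w] = omega_split s [u, v, w]"
    and s: "s \<noteq> 0" and t: "t \<noteq> 0"
  obtains e where "e = 1 \<or> e = -1" "\<And>u v w. eta_split t [L u, L v, L w] = e * eta_split s [u, v, w]"
proof -
  have surj: "surj L" using omega_split_pullback_bij[OF L pb] by (simp add: bij_def)
  have "plucker t (L v)" if "plucker s v" for v
    unfolding plucker_def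
  proof (intro allI)
    fix a b c d
    obtain a' b' c' d' where "a = L a'" "b = L b'" "c = L c'" "d = L d'" using surj by (metis surjD)
    then show "omega_split t [L v, a, b] * omega_split t [L v, c, d]
     - omega_split t [L v, a, c] * omega_split t [L v, b, d]
     + omega_split t [L v, a, d] * omega_split t [L v, b, c] = 0"
      using that unfolding plucker_def by (simp add: pb)
  qed
  then have un: "split_proj t (L v) = 0 \<or> split_proj (-t) (L v) = 0" if "split_proj s v = 0 \<or> split_proj (-s) v = 0" for v
    using that by (simp add: plucker_iff s t)
  \<comment> \<open>A subspace inside a union of two subspaces lies in one of them: otherwise the
    sum of \<open>v\<close> and \<open>w\<close> would lie in neither.\<close>
  have side: "(\<forall>v. split_proj r v = 0 \<longrightarrow> split_proj t (L v) = 0) \<or> (\<forall>v. split_proj r v = 0 \<longrightarrow> split_proj (-t) (L v) = 0)"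
    if r: "r = s \<or> r = -s" for r
  proof (rule ccontr)
    assume "\<not> ?thesis"
    then obtain v w where vw: "split_proj r v = 0" "split_proj t (L v) \<noteq> 0" "split_proj r w = 0" "split_proj (-t) (L w) \<noteq> 0"
      by blast
    then have "split_proj (-t) (L v) = 0" "split_proj t (L w) = 0" using un r by blast+
    moreover have "split_proj r (v + w) = 0" using vw by (simp add: linear_add[OF linear_split_proj])
    then have "split_proj t (L (v + w)) = 0 \<or> split_proj (-t) (L (v + w)) = 0" using un r by blast
    ultimately show False using vw by (simp add: linear_add[OF linear_split_proj] linear_add[OF L])
  qed
  \<comment> \<open>The two kernels span the space and \<open>L\<close> is onto, so sending both
    into one kernel would force \<open>split_proj r\<close> to vanish identically.\<close>
  have notboth: False
    if r: "r = t \<or> r = -t" and "\<And>v. split_proj s v = 0 \<Longrightarrow> split_proj r (L v) = 0"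
      "\<And>v. split_proj (-s) v = 0 \<Longrightarrow> split_proj r (L v) = 0" for r
  proof -
    have "split_proj r x = 0" for x
    proof -
      obtain v where "x = L v" using surj by (metis surjD)
      obtain p where p: "split_proj s p = 0" "split_proj (-s) p = split_proj (-s) v"
        using split_proj_surj[OF s] by metis
      then have "split_proj (-s) (v - p) = 0" by (simp add: linear_diff[OF linear_split_proj])
      then have "split_proj r (L (v - p)) = 0" "split_proj r (L p) = 0" using that p by blast+
      then show ?thesis using \<open>x = L v\<close> by (simp add: linear_diff[OF linear_split_proj] linear_diff[OF L])
    qed
    moreover have "split_proj r (axis 1 1) \<noteq> 0" by (auto simp: split_proj_def vec_eq_iff forall_3 axis_def)
    ultimately show False by blast
  qed
  show ?thesis
  proof (cases "\<forall>v. split_proj s v = 0 \<longrightarrow> split_proj t (L v) = 0")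
    case True
    then have "\<forall>v. split_proj (-s) v = 0 \<longrightarrow> split_proj (-t) (L v) = 0"
      using side[of "-s"] notboth[of t] by blast
    with True show ?thesis
      using eta_split_pullback_aligned[OF L pb s t] that[of 1] by simp
  next
    case False
    then have *: "\<forall>v. split_proj s v = 0 \<longrightarrow> split_proj (-t) (L v) = 0" using side[of s] by blast
    then have "\<forall>v. split_proj (-s) v = 0 \<longrightarrow> split_proj t (L v) = 0"
      using side[of "-s"] notboth[of "-t"] by blast
    \<comment> \<open>A swap is a match with \<open>-t\<close> in place of \<open>t\<close>, which
      fixes \<open>omega_split\<close> and negates \<open>eta_split\<close>.\<close>
    with * have "eta_split (-t) [L u, L v, L w] = eta_split s [u, v, w]" for u v w
      using s t by (intro eta_split_pullback_aligned[OF L]) (simp_all add: pb)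
    then show ?thesis using that[of "-1"] by (simp add: eta_split_minus minus_equation_iff)
  qed
qed

section \<open>Smooth maps and second derivatives\<close>

text \<open>\<open>frechet_derivative\<close> chooses from the predicate
  \<open>has_derivative\<close>, which is the same for \<open>f\<close> and \<open>g\<close>; so the
  equality also covers points without a derivative.\<close>

lemma frechet_derivative_cong_open:
  assumes "open S" "x \<in> S" "\<And>y. y \<in> S \<Longrightarrow> f y = g y"
  shows "frechet_derivative f (at x) = frechet_derivative g (at x)"
proof -
  have "(f has_derivative f') (at x) \<longleftrightarrow> (g has_derivative f') (at x)" for f'
    using has_derivative_transform_within_open[OF _ assms(1,2), of f f' UNIV g]
      has_derivative_transform_within_open[OF _ assms(1,2), of g f' UNIV f] assms(3) by auto
  then show ?thesis by (simp add: frechet_derivative_def)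
qed

lemma Ck_on_cong:
  assumes "open S" "\<And>x. x \<in> S \<Longrightarrow> f x = g x" "Ck_on n S f"
  shows "Ck_on n S g"
  using assms(2,3)
proof (induction n arbitrary: f g)
  case 0
  then show ?case by (metis Ck_on.simps(1) continuous_on_cong)
next
  case (Suc n)
  have "g differentiable (at x)" if "x \<in> S" for x
  proof -
    have "(f has_derivative frechet_derivative f (at x)) (at x)"
      using Suc.prems that by (simp add: frechet_derivative_works)
    then have "(g has_derivative frechet_derivative f (at x)) (at x)"
      by (rule has_derivative_transform_within_open[OF _ assms(1) that]) (use Suc.prems in auto)
    then show ?thesis by (auto simp: differentiable_def)
  qed
  moreover have "Ck_on n S (\<lambda>x. frechet_derivative g (at x) v)" for v
  proof (rule Suc.IH[of "\<lambda>x. frechet_derivative f (at x) v"])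
    show "frechet_derivative f (at x) v = frechet_derivative g (at x) v" if "x \<in> S" for x
      using frechet_derivative_cong_open[OF assms(1) that, of f g] Suc.prems(1) by simp
  qed (use Suc.prems in auto)
  ultimately show ?case by simp
qed

lemma smooth_on_cong:
  assumes "open S" "\<And>x. x \<in> S \<Longrightarrow> f x = g x" "smooth_on S f"
  shows "smooth_on S g"
  using assms Ck_on_cong unfolding smooth_on_def by blast

lemma Ck_on_const: "Ck_on n S (\<lambda>x. c)"
  by (induction n arbitrary: c) auto

lemma smooth_on_affine:
  fixes L :: "'a::euclidean_space \<Rightarrow> 'b::real_normed_vector"
  assumes "linear L"
  shows "smooth_on S (\<lambda>x. L x + c)"
  unfolding smooth_on_def
proof
  fix n
  have der: "((\<lambda>x. L x + c) has_derivative L) (at x)" for x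
    using linear_imp_has_derivative[OF assms, of "at x"] by (auto intro!: derivative_eq_intros)
  have *: "frechet_derivative (\<lambda>x. L x + c) (at x) = L" for x
    using frechet_derivative_at[OF der, of x] by simp
  show "Ck_on n S (\<lambda>x. L x + c)"
  proof (cases n)
    case 0
    have "continuous_on S (\<lambda>x. L x + c)"
      using der by (meson differentiable_imp_continuous_on differentiable_def differentiable_on_def has_derivative_at_withinI)
    with 0 show ?thesis by simp
  next
    case (Suc m)
    then show ?thesis using der by (auto simp: * Ck_on_const differentiable_def)
  qed
qed

section \<open>Symmetry of second derivatives\<close>

lemma has_derivative_vec_nth_comp:
  "(f has_derivative f') F \<Longrightarrow> ((\<lambda>x. f x $ i) has_derivative (\<lambda>h. f' h $ i)) F"
  by (rule bounded_linear.has_derivative[OF bounded_linear_vec_nth])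

text \<open>Two mean value theorems: along \<open>v\<close> for the difference of \<open>g\<close>
  on opposite sides of the parallelogram, then along \<open>u\<close> for the resulting difference
  of directional derivatives.\<close>

lemma second_difference_eq:
  fixes g :: "'a::euclidean_space \<Rightarrow> real"
  assumes g: "\<And>y. y \<in> ball x r \<Longrightarrow> g differentiable (at y)"
    and gv: "\<And>y. y \<in> ball x r \<Longrightarrow> (\<lambda>y. frechet_derivative g (at y) v) differentiable (at y)"
    and t: "0 < t" "t * (norm u + norm v) < r"
  obtains y where "y \<in> ball x r"
    "g (x + t *\<^sub>R u + t *\<^sub>R v) - g (x + t *\<^sub>R u) - g (x + t *\<^sub>R v) + g x
      = t\<^sup>2 * frechet_derivative (\<lambda>y. frechet_derivative g (at y) v) (at y) u"
proof -
  let ?G = "\<lambda>y. frechet_derivative g (at y) v"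
  have inb: "x + a *\<^sub>R u + b *\<^sub>R v \<in> ball x r" if "0 \<le> a" "a \<le> t" "0 \<le> b" "b \<le> t" for a b
  proof -
    have "dist x (x + a *\<^sub>R u + b *\<^sub>R v) = norm (a *\<^sub>R u + b *\<^sub>R v)"
      unfolding dist_commute[of x] by (simp add: dist_norm add.assoc)
    also have "\<dots> \<le> a * norm u + b * norm v"
      using norm_triangle_ineq[of "a *\<^sub>R u" "b *\<^sub>R v"] that by simp
    also have "\<dots> \<le> t * norm u + t * norm v" using that by (intro add_mono mult_right_mono) auto
    finally show ?thesis using t by (simp add: algebra_simps)
  qed
  have d1: "((\<lambda>b. g (x + a *\<^sub>R u + b *\<^sub>R v)) has_real_derivative ?G (x + a *\<^sub>R u + b *\<^sub>R v)) (at b)"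
    if "0 \<le> a" "a \<le> t" "0 \<le> b" "b \<le> t" for a b
  proof -
    have *: "(g has_derivative frechet_derivative g (at (x + a *\<^sub>R u + b *\<^sub>R v))) (at (x + a *\<^sub>R u + b *\<^sub>R v))"
      using g inb[OF that] by (simp add: frechet_derivative_works)
    have "((\<lambda>b. x + a *\<^sub>R u + b *\<^sub>R v) has_derivative (\<lambda>h. h *\<^sub>R v)) (at b)"
      by (auto intro!: derivative_eq_intros)
    from has_derivative_compose[OF this *] show ?thesis
      unfolding has_field_derivative_def
      by (rule has_derivative_eq_rhs) (simp add: fun_eq_iff linear_scale[OF has_derivative_linear[OF *]])
  qed
  obtain b where b: "0 < b" "b < t" and 1:
    "(g (x + t *\<^sub>R u + t *\<^sub>R v) - g (x + 0 *\<^sub>R u + t *\<^sub>R v)) - (g (x + t *\<^sub>R u + 0 *\<^sub>R v) - g (x + 0 *\<^sub>R u + 0 *\<^sub>R v))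
      = (t - 0) * (?G (x + t *\<^sub>R u + b *\<^sub>R v) - ?G (x + 0 *\<^sub>R u + b *\<^sub>R v))"
  proof -
    have "((\<lambda>b. g (x + t *\<^sub>R u + b *\<^sub>R v) - g (x + 0 *\<^sub>R u + b *\<^sub>R v)) has_real_derivative
        ?G (x + t *\<^sub>R u + b *\<^sub>R v) - ?G (x + 0 *\<^sub>R u + b *\<^sub>R v)) (at b)" if "0 \<le> b" "b \<le> t" for b
      by (rule DERIV_diff; rule d1) (use t(1) that in auto)
    from MVT2[OF t(1) this] show ?thesis using that by blast
  qed
  have d2: "((\<lambda>a. ?G (x + a *\<^sub>R u + b *\<^sub>R v)) has_real_derivative
      frechet_derivative ?G (at (x + a *\<^sub>R u + b *\<^sub>R v)) u) (at a)"
    if "0 \<le> a" "a \<le> t" for a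
  proof -
    have *: "(?G has_derivative frechet_derivative ?G (at (x + a *\<^sub>R u + b *\<^sub>R v))) (at (x + a *\<^sub>R u + b *\<^sub>R v))"
      using gv inb[OF that, of b] b by (simp add: frechet_derivative_works)
    have "((\<lambda>a. x + a *\<^sub>R u + b *\<^sub>R v) has_derivative (\<lambda>h. h *\<^sub>R u)) (at a)"
      by (auto intro!: derivative_eq_intros)
    from has_derivative_compose[OF this *] show ?thesis
      unfolding has_field_derivative_def
      by (rule has_derivative_eq_rhs) (simp add: fun_eq_iff linear_scale[OF has_derivative_linear[OF *]])
  qed
  obtain a where a: "0 < a" "a < t" and 2:
    "?G (x + t *\<^sub>R u + b *\<^sub>R v) - ?G (x + 0 *\<^sub>R u + b *\<^sub>R v)
      = (t - 0) * frechet_derivative ?G (at (x + a *\<^sub>R u + b *\<^sub>R v)) u"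
    using MVT2[OF t(1) d2] by blast
  show ?thesis
  proof (rule that)
    show "x + a *\<^sub>R u + b *\<^sub>R v \<in> ball x r" using inb a b by simp
    show "g (x + t *\<^sub>R u + t *\<^sub>R v) - g (x + t *\<^sub>R u) - g (x + t *\<^sub>R v) + g x
      = t\<^sup>2 * frechet_derivative ?G (at (x + a *\<^sub>R u + b *\<^sub>R v)) u"
      using 1 unfolding 2 by (simp add: power2_eq_square)
  qed
qed

text \<open>Schwarz's theorem. The second difference is symmetric in \<open>u\<close> and
  \<open>v\<close>, so the two mixed derivatives agree at suitable points \<open>y\<close> and
  \<open>z\<close> arbitrarily close to \<open>x\<close>; continuity carries this to
  \<open>x\<close>.\<close>

lemma symmetric_second_derivative:
  fixes g :: "'a::euclidean_space \<Rightarrow> real"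
  assumes U: "open U" "x \<in> U" and g: "Ck_on 2 U g"
  shows "frechet_derivative (\<lambda>y. frechet_derivative g (at y) v) (at x) u
       = frechet_derivative (\<lambda>y. frechet_derivative g (at y) u) (at x) v"
proof -
  let ?D = "\<lambda>u v y. frechet_derivative (\<lambda>y. frechet_derivative g (at y) v) (at y) u"
  have d1: "g differentiable (at y)" if "y \<in> U" for y using g that by (simp add: numeral_2_eq_2)
  have d2: "(\<lambda>y. frechet_derivative g (at y) v) differentiable (at y)" if "y \<in> U" for y v
    using g that by (simp add: numeral_2_eq_2)
  have cont: "isCont (?D u v) x" for u v
    using g U by (simp add: numeral_2_eq_2 continuous_on_eq_continuous_at)
  show ?thesis
  proof (rule ccontr)
    assume neq: "\<not> ?thesis"
    \<comment> \<open>Two errors below half the gap cannot bridge it.\<close>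
    define e where "e = \<bar>?D u v x - ?D v u x\<bar> / 2"
    have e: "e > 0" using neq by (simp add: e_def)
    obtain r1 where r1: "r1 > 0" "ball x r1 \<subseteq> U" by (rule openE[OF U])
    obtain r2 where r2: "r2 > 0" "\<And>y. dist y x < r2 \<Longrightarrow> dist (?D u v y) (?D u v x) < e"
      using cont[of v u, unfolded continuous_at_eps_delta, rule_format, OF e] by auto
    obtain r3 where r3: "r3 > 0" "\<And>y. dist y x < r3 \<Longrightarrow> dist (?D v u y) (?D v u x) < e"
      using cont[of u v, unfolded continuous_at_eps_delta, rule_format, OF e] by auto
    define r where "r = min r1 (min r2 r3)"
    \<comment> \<open>The extra 1 keeps the denominator positive and the bound for
      \<open>second_difference_eq\<close> strict.\<close>
    define t where "t = r / (norm u + norm v + 1)"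
    have r: "r > 0" using r1 r2 r3 by (simp add: r_def)
    have pos: "norm u + norm v + 1 > 0" by (smt (verit) norm_ge_zero)
    have t: "t > 0" unfolding t_def using r pos by simp
    have "t * (norm u + norm v + 1) = r" using pos by (simp add: t_def)
    then have tr: "t * (norm u + norm v) < r" using t by (simp add: algebra_simps)
    have sub: "ball x r \<subseteq> U" using r1 by (auto simp: r_def)
    have d1': "g differentiable (at y)" if "y \<in> ball x r" for y using d1 sub that by blast
    have d2': "(\<lambda>y. frechet_derivative g (at y) v) differentiable (at y)" if "y \<in> ball x r" for y v
      using d2 sub that by blast
    obtain y where y: "y \<in> ball x r"
      "g (x + t *\<^sub>R u + t *\<^sub>R v) - g (x + t *\<^sub>R u) - g (x + t *\<^sub>R v) + g x = t\<^sup>2 * ?D u v y"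
      by (rule second_difference_eq[OF d1' d2' t tr])
    have tr': "t * (norm v + norm u) < r" using tr by (simp add: add.commute)
    obtain z where z: "z \<in> ball x r"
      "g (x + t *\<^sub>R v + t *\<^sub>R u) - g (x + t *\<^sub>R v) - g (x + t *\<^sub>R u) + g x = t\<^sup>2 * ?D v u z"
      by (rule second_difference_eq[OF d1' d2' t tr'])
    have "x + t *\<^sub>R v + t *\<^sub>R u = x + t *\<^sub>R u + t *\<^sub>R v" by (simp add: algebra_simps)
    note z(2)[unfolded this]
    with y(2) have "t\<^sup>2 * ?D u v y = t\<^sup>2 * ?D v u z" by linarith
    then have "?D u v y = ?D v u z" using t by simp
    moreover have "dist (?D u v y) (?D u v x) < e"
      by (rule r2(2)) (use y(1) in \<open>simp add: r_def dist_commute\<close>)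
    moreover have "dist (?D v u z) (?D v u x) < e"
      by (rule r3(2)) (use z(1) in \<open>simp add: r_def dist_commute\<close>)
    ultimately show False by (auto simp: e_def dist_real_def abs_if split: if_splits)
  qed
qed

lemma Ck_on_vec_nth:
  assumes "open S" "Ck_on n S f"
  shows "Ck_on n S (\<lambda>x. f x $ i)"
  using assms(2)
proof (induction n arbitrary: f)
  case 0
  then show ?case by (auto intro: continuous_intros)
next
  case (Suc n)
  have der: "((\<lambda>x. f x $ i) has_derivative (\<lambda>h. frechet_derivative f (at x) h $ i)) (at x)" if "x \<in> S" for x
    using Suc.prems that by (intro has_derivative_vec_nth_comp) (simp add: frechet_derivative_works)
  have "Ck_on n S (\<lambda>x. frechet_derivative (\<lambda>x. f x $ i) (at x) v)" for v
  proof (rule Ck_on_cong[OF assms(1)])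
    show "Ck_on n S (\<lambda>x. frechet_derivative f (at x) v $ i)"
      using Suc by simp
    show "frechet_derivative f (at x) v $ i = frechet_derivative (\<lambda>x. f x $ i) (at x) v" if "x \<in> S" for x
      by (simp add: frechet_derivative_at[OF der[OF that], symmetric])
  qed
  then show ?case using der by (auto simp: differentiable_def)
qed

lemma symmetric_second_derivative_vec:
  fixes f :: "'a::euclidean_space \<Rightarrow> real ^ 'n"
  assumes U: "open U" "x \<in> U" and f: "Ck_on 2 U f"
  shows "frechet_derivative (\<lambda>y. frechet_derivative f (at y) v) (at x) u
       = frechet_derivative (\<lambda>y. frechet_derivative f (at y) u) (at x) v"
proof -
  have der: "frechet_derivative (\<lambda>x. f x $ i) (at y) h = frechet_derivative f (at y) h $ i"
    if "f differentiable (at y)" for f :: "'a \<Rightarrow> real ^ 'n" and y h i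
  proof -
    have "(f has_derivative frechet_derivative f (at y)) (at y)"
      using that by (simp add: frechet_derivative_works)
    from frechet_derivative_at[OF has_derivative_vec_nth_comp[OF this, of i]] show ?thesis by metis
  qed
  have d1: "f differentiable (at y)" if "y \<in> U" for y using f that by (simp add: numeral_2_eq_2)
  have d2: "(\<lambda>y. frechet_derivative f (at y) v) differentiable (at x)" for v
    using f U by (simp add: numeral_2_eq_2)
  have "frechet_derivative (\<lambda>y. frechet_derivative f (at y) v) (at x) u $ i
      = frechet_derivative (\<lambda>y. frechet_derivative (\<lambda>x. f x $ i) (at y) v) (at x) u" for i u v
    using frechet_derivative_cong_open[OF U, of "\<lambda>y. frechet_derivative (\<lambda>x. f x $ i) (at y) v" "\<lambda>y. frechet_derivative f (at y) v $ i"]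
    by (simp add: der d1 d2)
  then show ?thesis
    using symmetric_second_derivative[OF U Ck_on_vec_nth[OF U(1) f]] by (simp add: vec_eq_iff)
qed

section \<open>Invariance of the exterior derivative\<close>

lemma has_derivative_dx_3:
  assumes A: "(A has_derivative A') (at x)" and B: "(B has_derivative B') (at x)" and C: "(C has_derivative C') (at x)"
  shows "((\<lambda>y. dx [i, j, k] [A y, B y, C y]) has_derivative
     (\<lambda>h. dx [i, j, k] [A' h, B x, C x] + dx [i, j, k] [A x, B' h, C x] + dx [i, j, k] [A x, B x, C' h])) (at x)"
  unfolding dx_3
  by (rule has_derivative_eq_rhs)
     (auto intro!: derivative_eq_intros A[THEN has_derivative_vec_nth_comp] B[THEN has_derivative_vec_nth_comp]
        C[THEN has_derivative_vec_nth_comp] simp: fun_eq_iff algebra_simps)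

text \<open>The derivative of \<open>eta_split s\<close> with respect to \<open>s\<close>.\<close>

definition eta_split' :: "real \<Rightarrow> (real ^ 6) covector" where
  "eta_split' s vs = - (dx [1, 3, 6] vs / s\<^sup>2) - (dx [1, 4, 5] vs + dx [2, 3, 5] vs - dx [2, 4, 6] vs)"

lemma has_derivative_eta_split:
  assumes g: "(g has_derivative g') (at x)" "g x \<noteq> 0"
    and A: "(A has_derivative A') (at x)" and B: "(B has_derivative B') (at x)" and C: "(C has_derivative C') (at x)"
  shows "((\<lambda>y. eta_split (g y) [A y, B y, C y]) has_derivative
     (\<lambda>h. g' h * eta_split' (g x) [A x, B x, C x] + eta_split (g x) [A' h, B x, C x]
        + eta_split (g x) [A x, B' h, C x] + eta_split (g x) [A x, B x, C' h])) (at x)"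
  unfolding eta_split_def
  by (rule has_derivative_eq_rhs, (rule derivative_intros has_derivative_dx_3 g A B C)+)
     (simp add: eta_split'_def fun_eq_iff field_simps power2_eq_square g(2))

text \<open>The exterior derivative of \<open>x \<mapsto> eta_split (\<sigma> x)\<close> at a point where \<open>\<sigma>\<close> has the value \<open>s\<close> and the
  derivative \<open>l\<close>.\<close>

definition d_eta :: "real \<Rightarrow> (real ^ 6 \<Rightarrow> real) \<Rightarrow> (real ^ 6) covector" where
  "d_eta s l vs = l (vs!0) * eta_split' s [vs!1, vs!2, vs!3] - l (vs!1) * eta_split' s [vs!0, vs!2, vs!3]
     + l (vs!2) * eta_split' s [vs!0, vs!1, vs!3] - l (vs!3) * eta_split' s [vs!0, vs!1, vs!2]"

text \<open>With \<open>J\<close> and \<open>D\<close> the first and second derivatives of a map,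
  this is the second-order part of the exterior derivative of a pulled-back monomial. Each value of
  \<open>D\<close> occurs twice, with opposite signs by alternation.\<close>

lemma dx_3_second_order_cancel:
  assumes "\<And>a b. D a b = D b a"
  shows "(dx [i, j, k] [D a b, J c, J d] + dx [i, j, k] [J b, D a c, J d] + dx [i, j, k] [J b, J c, D a d])
     - (dx [i, j, k] [D b a, J c, J d] + dx [i, j, k] [J a, D b c, J d] + dx [i, j, k] [J a, J c, D b d])
     + (dx [i, j, k] [D c a, J b, J d] + dx [i, j, k] [J a, D c b, J d] + dx [i, j, k] [J a, J b, D c d])
     - (dx [i, j, k] [D d a, J b, J c] + dx [i, j, k] [J a, D d b, J c] + dx [i, j, k] [J a, J b, D d c]) = 0"
  by (simp only: dx_3 assms[of b a] assms[of c a] assms[of d a] assms[of c b] assms[of d b] assms[of d c]) algebra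

lemma eta_split_second_order_cancel:
  assumes "\<And>a b. D a b = D b a"
  shows "(eta_split s [D a b, J c, J d] + eta_split s [J b, D a c, J d] + eta_split s [J b, J c, D a d])
     - (eta_split s [D b a, J c, J d] + eta_split s [J a, D b c, J d] + eta_split s [J a, J c, D b d])
     + (eta_split s [D c a, J b, J d] + eta_split s [J a, D c b, J d] + eta_split s [J a, J b, D c d])
     - (eta_split s [D d a, J b, J c] + eta_split s [J a, D d b, J c] + eta_split s [J a, J b, D d c]) = 0"
proof -
  note c = dx_3_second_order_cancel[of D _ _ _ a b J c d, OF assms]
  have "X136 / s - s * (X145 + X235 - X246) = (0::real)" if "X136 = 0" "X145 = 0" "X235 = 0" "X246 = 0" for X136 X145 X235 X246
    using that by simp
  from this[OF c[of 1 3 6] c[of 1 4 5] c[of 2 3 5] c[of 2 4 6]]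
  show ?thesis unfolding eta_split_def by (simp add: add_divide_distrib diff_divide_distrib algebra_simps)
qed

text \<open>Naturality of the exterior derivative. The identity holds near \<open>x\<close> and so
  can be differentiated there, with each of the four vectors in turn as direction; the alternating
  sum removes the second derivatives of \<open>\<phi>\<close>.\<close>

lemma d_eta_pullback:
  assumes U: "open U" "x \<in> U" and phi: "Ck_on 2 U \<phi>"
    and \<sigma>: "(\<sigma> has_derivative \<sigma>') (at (\<phi> x))" "\<sigma> (\<phi> x) \<noteq> 0"
    and \<tau>: "(\<tau> has_derivative \<tau>') (at x)" "\<tau> x \<noteq> 0"
    and inv: "\<And>u v w. eventually (\<lambda>y. eta_split (\<sigma> (\<phi> y))
        (map (frechet_derivative \<phi> (at y)) [u, v, w]) = e * eta_split (\<tau> y) [u, v, w]) (nhds x)"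
    and len: "length vs = 4"
  shows "d_eta (\<sigma> (\<phi> x)) \<sigma>' (map (frechet_derivative \<phi> (at x)) vs) = e * d_eta (\<tau> x) \<tau>' vs"
proof -
  obtain a b c d where vs: "vs = [a, b, c, d]"
    using len by (auto simp: length_Suc_conv eval_nat_numeral)
  define J where "J = (\<lambda>y. frechet_derivative \<phi> (at y))"
  define D where "D = (\<lambda>h v. frechet_derivative (\<lambda>y. frechet_derivative \<phi> (at y) v) (at x) h)"
  have sym: "D h v = D v h" for h v
    unfolding D_def by (rule symmetric_second_derivative_vec[OF U phi])
  have phi1: "(\<phi> has_derivative J x) (at x)"
    using phi U by (simp add: J_def numeral_2_eq_2 frechet_derivative_works)
  have phi2: "((\<lambda>y. J y v) has_derivative (\<lambda>h. D h v)) (at x)" for v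
    using phi U by (simp add: J_def D_def numeral_2_eq_2 frechet_derivative_works)
  have \<sigma>\<phi>: "((\<lambda>y. \<sigma> (\<phi> y)) has_derivative (\<lambda>h. \<sigma>' (J x h))) (at x)"
    by (rule has_derivative_compose[OF phi1 \<sigma>(1)])
  have eq: "\<sigma>' (J x h) * eta_split' (\<sigma> (\<phi> x)) [J x u, J x v, J x w]
        + eta_split (\<sigma> (\<phi> x)) [D h u, J x v, J x w]
        + eta_split (\<sigma> (\<phi> x)) [J x u, D h v, J x w] + eta_split (\<sigma> (\<phi> x)) [J x u, J x v, D h w]
      = e * (\<tau>' h * eta_split' (\<tau> x) [u, v, w])" (is "?l h = ?r h") for h u v w
  proof -
    have l: "((\<lambda>y. eta_split (\<sigma> (\<phi> y)) [J y u, J y v, J y w]) has_derivative ?l) (at x)"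
      by (rule has_derivative_eta_split[OF \<sigma>\<phi> \<sigma>(2) phi2 phi2 phi2])
    \<comment> \<open>The arguments are constant, so only the derivative of the coefficients is
      left.\<close>
    have "((\<lambda>y. eta_split (\<tau> y) [u, v, w]) has_derivative (\<lambda>h. \<tau>' h * eta_split' (\<tau> x) [u, v, w])) (at x)"
      using has_derivative_eta_split[OF \<tau> has_derivative_const has_derivative_const has_derivative_const, of u v w]
      by (simp add: eta_split_def dx_3)
    then have r: "((\<lambda>y. e * eta_split (\<tau> y) [u, v, w]) has_derivative ?r) (at x)"
      by (rule has_derivative_mult_right)
    have ev: "eventually (\<lambda>y. e * eta_split (\<tau> y) [u, v, w] = eta_split (\<sigma> (\<phi> y)) [J y u, J y v, J y w]) (nhds x)"
      using inv[of u v w] by eventually_elim (simp add: J_def)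
    have "((\<lambda>y. eta_split (\<sigma> (\<phi> y)) [J y u, J y v, J y w]) has_derivative ?r) (at x)"
      by (rule has_derivative_transform_eventually[OF r filter_leD[OF at_within_le_nhds ev]
            eventually_nhds_x_imp_x[OF ev] UNIV_I])
    from has_derivative_unique[OF l this] show ?thesis by (rule fun_cong)
  qed
  show ?thesis
    using eq[of a b c d] eq[of b a c d] eq[of c a b d] eq[of d a b c]
      eta_split_second_order_cancel[of D, OF sym, of "\<sigma> (\<phi> x)" a b "J x" c d]
    unfolding vs d_eta_def J_def by (simp add: algebra_simps)
qed

text \<open>A triple on which the form is nonzero, used to read off the sign of a pullback.\<close>

lemma eta_split_basis: "eta_split s [axis 1 1, axis 3 1, axis 6 1] = 1 / s"
  by (simp add: eta_split_def dx_3 axis_def)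

text \<open>\<open>eta_split_pullback\<close> gives a sign at each point, whereas
  \<open>d_eta_pullback\<close> needs one sign near \<open>x\<close>. Separate
  \<open>\<sigma>\<close> and \<open>\<tau>\<close> serve charts into a constant form as well as
  symmetries of \<open>omega\<close>.\<close>

lemma d_eta_pullback_of_omega:
  assumes U: "open U" "x \<in> U" and phi: "Ck_on 2 U \<phi>"
    and \<sigma>: "(\<sigma> has_derivative \<sigma>') (at (\<phi> x))" "\<And>y. y \<in> U \<Longrightarrow> \<sigma> (\<phi> y) \<noteq> 0"
    and \<tau>: "(\<tau> has_derivative \<tau>') (at x)" "\<And>y. y \<in> U \<Longrightarrow> \<tau> y \<noteq> 0"
    and inv: "\<And>y u v w. y \<in> U \<Longrightarrow> omega_split (\<sigma> (\<phi> y))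
        (map (frechet_derivative \<phi> (at y)) [u, v, w]) = omega_split (\<tau> y) [u, v, w]"
  obtains e where "e = 1 \<or> e = -1"
    "\<And>vs. length vs = 4 \<Longrightarrow>
       d_eta (\<sigma> (\<phi> x)) \<sigma>' (map (frechet_derivative \<phi> (at x)) vs) = e * d_eta (\<tau> x) \<tau>' vs"
proof -
  let ?J = "\<lambda>y. frechet_derivative \<phi> (at y)"
  have d1: "(\<phi> has_derivative ?J y) (at y)" if "y \<in> U" for y
    using phi that by (simp add: numeral_2_eq_2 frechet_derivative_works)
  have "\<exists>e. (e = 1 \<or> e = -1) \<and> (\<forall>u v w. eta_split (\<sigma> (\<phi> y)) [?J y u, ?J y v, ?J y w] = e * eta_split (\<tau> y) [u, v, w])"
    if "y \<in> U" for y
  proof -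
    have "omega_split (\<sigma> (\<phi> y)) [?J y u, ?J y v, ?J y w] = omega_split (\<tau> y) [u, v, w]" for u v w
      using inv[OF that] by simp
    from eta_split_pullback[OF has_derivative_linear[OF d1[OF that]] this \<tau>(2)[OF that] \<sigma>(2)[OF that]]
    show ?thesis by metis
  qed
  then obtain \<epsilon> where \<epsilon>: "\<And>y. y \<in> U \<Longrightarrow> \<epsilon> y = 1 \<or> \<epsilon> y = -1"
    "\<And>y u v w. y \<in> U \<Longrightarrow> eta_split (\<sigma> (\<phi> y)) [?J y u, ?J y v, ?J y w] = \<epsilon> y * eta_split (\<tau> y) [u, v, w]"
    by metis
  \<comment> \<open>\<open>k\<close> expresses the sign \<open>\<epsilon>\<close> through \<open>\<phi>\<close>, which shows that it is continuous, hence locally constant.\<close>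
  define k where "k = (\<lambda>y. eta_split (\<sigma> (\<phi> y)) [?J y (axis 1 1), ?J y (axis 3 1), ?J y (axis 6 1)] * \<tau> y)"
  have k: "k y = \<epsilon> y" if "y \<in> U" for y
    using \<epsilon>(2)[OF that] \<tau>(2)[OF that] by (simp add: k_def eta_split_basis)
  have "((\<lambda>y. ?J y v) has_derivative frechet_derivative (\<lambda>y. ?J y v) (at x)) (at x)" for v
    using phi U by (simp add: numeral_2_eq_2 frechet_derivative_works)
  note has_derivative_eta_split[OF has_derivative_compose[OF d1[OF U(2)] \<sigma>(1)] \<sigma>(2)[OF U(2)] this this this]
  from has_derivative_mult[OF this \<tau>(1)] have "isCont k x"
    unfolding k_def by (rule has_derivative_continuous)
  then have "eventually (\<lambda>y. dist (k y) (k x) < 1) (nhds x)"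
    unfolding isCont_def tendsto_at_iff_tendsto_nhds by (auto dest: tendstoD[where e = 1])
  moreover have evU: "eventually (\<lambda>y. y \<in> U) (nhds x)" using U by (rule eventually_nhds_in_open)
  ultimately have "eventually (\<lambda>y. y \<in> U \<and> \<epsilon> y = \<epsilon> x) (nhds x)"
  proof eventually_elim
    case (elim y)
    \<comment> \<open>The values 1 and -1 are 2 apart, so a distance below 1 forces equal
      signs.\<close>
    then show ?case using \<epsilon>(1)[OF U(2)] \<epsilon>(1)[of y] k[OF U(2)] k[of y] by (auto simp: dist_real_def)
  qed
  then have "eventually (\<lambda>y. eta_split (\<sigma> (\<phi> y)) (map (?J y) [u, v, w]) = \<epsilon> x * eta_split (\<tau> y) [u, v, w]) (nhds x)" for u v w
    by eventually_elim (use \<epsilon>(2) in force)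
  from d_eta_pullback[OF U phi \<sigma>(1) \<sigma>(2)[OF U(2)] \<tau>(1) \<tau>(2)[OF U(2)] this] \<epsilon>(1)[OF U(2)]
  show ?thesis using that by blast
qed

section \<open>The half space\<close>

lemma open_M_pos: "open M_pos"
  unfolding M_pos_def by (intro open_Collect_less continuous_intros)

lemma omega_M_pos:
  assumes "\<And>t. t > 0 \<Longrightarrow> f t = t" "x \<in> M_pos"
  shows "omega f x = omega_split (sqrt (x $ 2))"
  using assms omega_eq_split[of x f] by (simp add: M_pos_def)

lemma multisymplectic_omega:
  assumes f: "\<And>t. t > 0 \<Longrightarrow> f t = t"
  shows "multisymplectic 2 M_pos (omega f)"
proof -
  \<comment> \<open>For fixed \<open>vs\<close> the form is affine in the second coordinate on the
    half space, with constant part \<open>K\<close>; elsewhere \<open>f\<close> is arbitrary, hence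
    the passage through \<open>om\<close>.\<close>
  define K where "K = (\<lambda>vs :: (real ^ 6) list. dx [1, 3, 5] vs - dx [1, 4, 6] vs - dx [2, 3, 6] vs :: real)"
  have om: "x $ 2 * dx [2, 4, 5] vs + K vs = omega f x vs" if "x \<in> M_pos" for x vs
    using that by (simp add: f M_pos_def omega_def K_def)
  have lin: "linear (\<lambda>x. x $ 2 * c)" for c :: real
    by (rule linearI) (auto simp: algebra_simps)
  have smooth: "smooth_on M_pos (\<lambda>p. omega f p vs)" for vs
    by (rule smooth_on_cong[OF open_M_pos om smooth_on_affine[OF lin]])
  have alt: "alternating_form 3 (omega f p)" for p
    unfolding alternating_form_def
  proof (intro allI impI conjI)
    fix vs :: "(real ^ 6) list" and i :: nat assume "length vs = 3" "i < 3"
    then obtain u v w where "vs = [u, v, w]" by (elim list_length_3E)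
    moreover have "i = 0 \<or> i = 1 \<or> i = 2" using \<open>i < 3\<close> by linarith
    ultimately show "linear (\<lambda>v. omega f p (vs[i := v]))"
      by (auto simp: linear_iff omega_def dx_3 algebra_simps)
  next
    fix vs :: "(real ^ 6) list" assume "length vs = 3" "\<not> distinct vs"
    then show "omega f p vs = 0"
      by (elim list_length_3E) (auto simp: omega_def dx_3 algebra_simps)
  qed
  have der: "frechet_derivative (\<lambda>x. omega f x vs) (at p) h = h $ 2 * dx [2, 4, 5] vs" if "p \<in> M_pos" for p vs h
  proof -
    have "((\<lambda>x. x $ 2 * dx [2, 4, 5] vs + K vs) has_derivative (\<lambda>h. h $ 2 * dx [2, 4, 5] vs)) (at p)"
      using has_derivative_add[OF linear_imp_has_derivative[OF lin] has_derivative_const] by simp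
    note frechet_derivative_at[OF this, symmetric]
    moreover have "frechet_derivative (\<lambda>x. x $ 2 * dx [2, 4, 5] vs + K vs) (at p)
        = frechet_derivative (\<lambda>x. omega f x vs) (at p)"
      by (rule frechet_derivative_cong_open[OF open_M_pos that om])
    ultimately show ?thesis by simp
  qed
  \<comment> \<open>The only non-constant coefficient contributes dx2 wedge dx245 = 0.\<close>
  have closed: "closed_form 3 M_pos (omega f)"
    unfolding closed_form_def form_eq_def
  proof (intro ballI allI impI)
    fix p and vs :: "(real ^ 6) list" assume p: "p \<in> M_pos" and "length vs = Suc 3"
    then obtain a b c d where "vs = [a, b, c, d]" by (auto simp: length_Suc_conv eval_nat_numeral)
    then show "ext_deriv (omega f) p vs = 0"
      by (simp add: ext_deriv_def der[OF p] dx_3 lessThan_Suc eval_nat_numeral algebra_simps)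
  qed
  have "inj (\<lambda>v. restrict (contract v (omega f p)) {vs. length vs = 2})" if p: "p \<in> M_pos" for p
  proof (rule injI)
    fix x y assume eq: "restrict (contract x (omega f p)) {vs. length vs = 2} = restrict (contract y (omega f p)) {vs. length vs = 2}"
    have "omega_split (sqrt (p $ 2)) [x - y, v, w] = 0" for v w
    proof -
      have "omega_split (sqrt (p $ 2)) [x, v, w] = omega_split (sqrt (p $ 2)) [y, v, w]"
        using fun_cong[OF eq, of "[v, w]"] by (simp add: contract_def omega_M_pos[OF f p])
      then show ?thesis
        by (simp add: omega_split_def dx_3 algebra_simps)
    qed
    then have "x - y = 0" by (rule omega_split_nondegenerate)
    then show "x = y" by simp
  qed
  then show ?thesis
    using open_M_pos smooth alt closed
    by (simp add: multisymplectic_def differential_form_def eval_nat_numeral)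
qed

section \<open>Constant linear type and transitivity by affine maps\<close>

text \<open>The weights are chosen so that \<open>x\<^sup>2\<close> scales by \<open>m\<^sup>2\<close> while all four monomials of the form
  keep their value.\<close>

definition weighted_dilation :: "real \<Rightarrow> real ^ 6 \<Rightarrow> real ^ 6" where
  "weighted_dilation m v = (\<chi> i. (if i = 1 then m ^ 3 else if i = 2 then m\<^sup>2 else if i = 3 then m
     else if i = 4 then 1 else if i = 5 then inverse m ^ 4 else inverse m ^ 3) * v $ i)"

lemma linear_weighted_dilation: "linear (weighted_dilation m)"
  by (rule linearI) (auto simp: weighted_dilation_def vec_eq_iff algebra_simps)

lemma weighted_dilation_inverse:
  "m \<noteq> 0 \<Longrightarrow> weighted_dilation (inverse m) (weighted_dilation m v) = v"
  by (simp add: weighted_dilation_def vec_eq_iff forall_6 field_simps)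

lemma omega_split_weighted_dilation:
  assumes "m \<noteq> 0"
  shows "omega_split (m * s) [weighted_dilation m u, weighted_dilation m v, weighted_dilation m w]
    = omega_split s [u, v, w]"
  using assms by (simp add: omega_split_def dx_3 weighted_dilation_def field_simps power2_eq_square eval_nat_numeral)

lemma constant_linear_type_omega:
  assumes f: "\<And>t. t > 0 \<Longrightarrow> f t = t"
  shows "constant_linear_type 3 M_pos (omega f)"
  unfolding constant_linear_type_def
proof (intro ballI)
  fix p q assume p: "p \<in> M_pos" and q: "q \<in> M_pos"
  \<comment> \<open>The dilation multiplies the second coordinate by \<open>m\<^sup>2\<close>, so
    this \<open>m\<close> turns \<open>p $ 2\<close> into \<open>q $ 2\<close>.\<close>
  define m where "m = sqrt (q $ 2) / sqrt (p $ 2)"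
  have m: "m \<noteq> 0" "sqrt (q $ 2) = m * sqrt (p $ 2)" using p q by (auto simp: m_def M_pos_def)
  have pb: "omega_split (sqrt (q $ 2)) [weighted_dilation m u, weighted_dilation m v, weighted_dilation m w]
      = omega_split (sqrt (p $ 2)) [u, v, w]" for u v w
    unfolding m(2) by (rule omega_split_weighted_dilation[OF m(1)])
  show "\<exists>L. linear L \<and> bij L \<and> form_eq 3 (linear_pullback L (omega f q)) (omega f p)"
  proof (intro exI conjI)
    show "linear (weighted_dilation m)" by (rule linear_weighted_dilation)
    show "bij (weighted_dilation m)"
      by (rule omega_split_pullback_bij[OF linear_weighted_dilation pb])
    show "form_eq 3 (linear_pullback (weighted_dilation m) (omega f q)) (omega f p)"
      by (auto simp: form_eq_def linear_pullback_def omega_M_pos[OF f p] omega_M_pos[OF f q] pb elim!: list_length_3E)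
  qed
qed

lemma frechet_derivative_restrict_affine:
  fixes L :: "'a::euclidean_space \<Rightarrow> 'b::real_normed_vector"
  assumes "open S" "x \<in> S" "linear L"
  shows "frechet_derivative (restrict (\<lambda>x. L x + c) S) (at x) = L"
proof -
  have "frechet_derivative (restrict (\<lambda>x. L x + c) S) (at x) = frechet_derivative (\<lambda>x. L x + c) (at x)"
    by (rule frechet_derivative_cong_open[OF assms(1,2)]) simp
  moreover have "((\<lambda>x. L x + c) has_derivative L) (at x)"
    using has_derivative_add[OF linear_imp_has_derivative[OF assms(3)] has_derivative_const] by simp
  ultimately show ?thesis using frechet_derivative_at by metis
qed

lemma diffeomorphism_restrict_affine:
  assumes S: "open S" and L: "linear L" "linear L'" and inv: "\<And>x. L' (L x) = x" "\<And>x. L (L' x) = x"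
    and maps: "\<And>x. x \<in> S \<Longrightarrow> L x + c \<in> S" "\<And>x. x \<in> S \<Longrightarrow> L' (x - c) \<in> S"
  shows "diffeomorphism S S (restrict (\<lambda>x. L x + c) S)"
proof -
  let ?\<phi> = "restrict (\<lambda>x. L x + c) S"
  have bij: "bij_betw ?\<phi> S S"
    by (rule bij_betw_byWitness[where f' = "\<lambda>x. L' (x - c)"]) (use maps in \<open>auto simp: inv\<close>)
  have "inv_into S ?\<phi> y = L' y + - L' c" if "y \<in> S" for y
  proof -
    have "?\<phi> (L' (y - c)) = y" using maps(2)[OF that] by (simp add: inv)
    then have "inv_into S ?\<phi> y = L' (y - c)"
      using inv_into_f_f[OF bij_betw_imp_inj_on[OF bij] maps(2)[OF that]] by simp
    then show ?thesis by (simp add: linear_diff[OF L(2)])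
  qed
  then have "smooth_on S (inv_into S ?\<phi>)"
    by (intro smooth_on_cong[OF S _ smooth_on_affine[OF L(2), of S "- L' c"]]) simp
  moreover have "smooth_on S ?\<phi>"
    by (rule smooth_on_cong[OF S _ smooth_on_affine[OF L(1), of S c]]) simp
  ultimately show ?thesis using S bij by (simp add: diffeomorphism_def)
qed

lemma transitive_1_omega:
  assumes f: "\<And>t. t > 0 \<Longrightarrow> f t = t"
  shows "k_transitive 1 (multisymplectic_diffeos 3 M_pos (omega f)) (\<lambda>\<phi> x. \<phi> x) M_pos"
proof -
  have "\<exists>g\<in>multisymplectic_diffeos 3 M_pos (omega f). g p = q" if p: "p \<in> M_pos" and q: "q \<in> M_pos" for p q
  proof -
    define m where "m = sqrt (q $ 2) / sqrt (p $ 2)"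
    define L where "L = weighted_dilation m"
    \<comment> \<open>The translation corrects the other coordinates. Its second component is 0, as
      the dilation already turns \<open>p $ 2\<close> into \<open>q $ 2\<close>; so it preserves the
      half space and the form.\<close>
    define c where "c = q - L p"
    have m: "m > 0" "m\<^sup>2 * p $ 2 = q $ 2" using p q by (auto simp: m_def M_pos_def power_divide)
    have L: "linear L" unfolding L_def by (rule linear_weighted_dilation)
    have L2: "L x $ 2 = m\<^sup>2 * x $ 2" for x by (simp add: L_def weighted_dilation_def)
    have c2: "c $ 2 = 0" using m by (simp add: c_def L2)
    let ?\<phi> = "restrict (\<lambda>x. L x + c) M_pos"
    have "diffeomorphism M_pos M_pos ?\<phi>"
    proof (rule diffeomorphism_restrict_affine[OF open_M_pos L, of "weighted_dilation (inverse m)"])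
      show "linear (weighted_dilation (inverse m))" by (rule linear_weighted_dilation)
      show "weighted_dilation (inverse m) (L x) = x" for x
        using m by (simp add: L_def weighted_dilation_inverse)
      show "L (weighted_dilation (inverse m) x) = x" for x
        using m weighted_dilation_inverse[of "inverse m"] by (simp add: L_def)
      show "L x + c \<in> M_pos" if "x \<in> M_pos" for x
        using that m by (simp add: M_pos_def L2 c2)
      show "weighted_dilation (inverse m) (x - c) \<in> M_pos" if "x \<in> M_pos" for x
        using that m by (simp add: M_pos_def weighted_dilation_def c2)
    qed
    moreover have "form_eq 3 (pullback ?\<phi> (omega f) x) (omega f x)" if x: "x \<in> M_pos" for x
    proof -
      have y: "L x + c \<in> M_pos" using x m by (simp add: M_pos_def L2 c2)
      have "sqrt ((L x + c) $ 2) = m * sqrt (x $ 2)" using m by (simp add: L2 c2 real_sqrt_mult)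
      then show ?thesis
        using m x by (auto simp: form_eq_def pullback_def linear_pullback_def omega_M_pos[OF f x] omega_M_pos[OF f y]
            frechet_derivative_restrict_affine[OF open_M_pos x L] L_def[symmetric]
            omega_split_weighted_dilation[of m, folded L_def] elim!: list_length_3E)
    qed
    ultimately have "?\<phi> \<in> multisymplectic_diffeos 3 M_pos (omega f)"
      by (simp add: multisymplectic_diffeos_def)
    moreover have "?\<phi> p = q" using p by (simp add: c_def)
    ultimately show ?thesis by blast
  qed
  then show ?thesis
    by (auto simp: k_transitive_def length_Suc_conv)
qed

section \<open>Non-flatness\<close>

lemma has_derivative_sqrt_coord:
  assumes "x $ 2 > 0"
  shows "((\<lambda>y :: real ^ 6. sqrt (y $ 2)) has_derivative (\<lambda>h. h $ 2 / (2 * sqrt (x $ 2)))) (at x)"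
proof -
  have "((\<lambda>y :: real ^ 6. y $ 2) has_derivative (\<lambda>h. h $ 2)) (at x)"
    by (rule has_derivative_vec_nth_comp[OF has_derivative_ident])
  from has_derivative_real_sqrt[OF assms this] show ?thesis
    by (rule has_derivative_eq_rhs) (simp add: fun_eq_iff field_simps)
qed

lemma not_flat_omega:
  assumes f: "\<And>t. t > 0 \<Longrightarrow> f t = t"
  shows "\<not> flat 3 M_pos (omega f)"
proof
  assume "flat 3 M_pos (omega f)"
  define p :: "real ^ 6" where "p = axis 2 1"
  have p: "p \<in> M_pos" "p $ 2 = 1" by (auto simp: p_def M_pos_def axis_def)
  obtain U V \<phi> where U: "open U" "p \<in> U" "U \<subseteq> M_pos" and d: "diffeomorphism U (V :: (real ^ 6) set) \<phi>"
    and pb: "\<And>x. x \<in> U \<Longrightarrow> form_eq 3 (pullback \<phi> (\<lambda>_. omega f p) x) (omega f x)"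
    using \<open>flat 3 M_pos (omega f)\<close> p(1) unfolding flat_def by metis
  have C2: "Ck_on 2 U \<phi>" using d by (simp add: diffeomorphism_def smooth_on_def)
  \<comment> \<open>In a flat chart the target form is constant, so \<open>\<sigma> = 1\<close> has
    derivative 0 and the left-hand \<open>d_eta\<close> vanishes.\<close>
  obtain e where "e = 1 \<or> e = (-1 :: real)" and e: "\<And>vs. length vs = 4 \<Longrightarrow>
       d_eta 1 (\<lambda>_. 0) (map (frechet_derivative \<phi> (at p)) vs)
       = e * d_eta (sqrt (p $ 2)) (\<lambda>h. h $ 2 / (2 * sqrt (p $ 2))) vs"
  proof (rule d_eta_pullback_of_omega[OF U(1,2) C2, where \<sigma> = "\<lambda>_. 1" and \<tau> = "\<lambda>y. sqrt (y $ 2)"])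
    show "((\<lambda>y. sqrt (y $ 2)) has_derivative (\<lambda>h. h $ 2 / (2 * sqrt (p $ 2)))) (at p)"
      by (rule has_derivative_sqrt_coord) (simp add: p)
    show "sqrt (y $ 2) \<noteq> 0" if "y \<in> U" for y using that U by (auto simp: M_pos_def)
    show "omega_split 1 (map (frechet_derivative \<phi> (at y)) [u, v, w]) = omega_split (sqrt (y $ 2)) [u, v, w]"
      if "y \<in> U" for y u v w
    proof -
      have y: "y \<in> M_pos" using that U by blast
      show ?thesis
        using pb[OF that, unfolded form_eq_def, rule_format, of "[u, v, w]"]
        by (simp add: pullback_def linear_pullback_def omega_M_pos[OF f p(1)] omega_M_pos[OF f y] p(2))
    qed
  qed auto
  \<comment> \<open>These basis vectors detect dx1236, whose coefficient in this 4-form is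
    1/2.\<close>
  have "d_eta 1 (\<lambda>h. h $ 2 / 2) [axis 1 1, axis 2 1, axis 3 1, axis 6 1] = 0"
    using e[of "[axis 1 1, axis 2 1, axis 3 1, axis 6 1]"] \<open>e = 1 \<or> e = -1\<close> by (auto simp: d_eta_def p)
  then show False by (simp add: d_eta_def eta_split'_def dx_3 axis_def)
qed

section \<open>The invariant foliation and failure of 2-transitivity\<close>

lemma d_eta_kernel_pair:
  assumes s: "s > 0" and k: "k \<noteq> 0" and ker: "\<And>a b. d_eta s (\<lambda>h. k * h $ 2) [v, w, a, b] = 0"
    and indep: "\<And>c. v \<noteq> c *\<^sub>R w" "\<And>c. w \<noteq> c *\<^sub>R v"
  shows "v $ 1 = 0 \<and> v $ 2 = 0 \<and> w $ 1 = 0 \<and> w $ 2 = 0"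
proof -
  \<comment> \<open>Basis pairs extract the 2 by 2 minors of \<open>v\<close> and \<open>w\<close>
    involving coordinate 1 or 2. If such a coordinate of one vector were nonzero, the vanishing
    minors would make the other a multiple of it.\<close>
  note K = ker[unfolded d_eta_def eta_split'_def dx_3]
  have e: "v$1 * w$2 = v$2 * w$1" using K[of "axis 3 1" "axis 6 1"] s k by (simp add: axis_def field_simps)
  have e13: "v$2 * w$6 = v$6 * w$2" using K[of "axis 1 1" "axis 3 1"] s k by (simp add: axis_def field_simps)
  have e16: "v$2 * w$3 = v$3 * w$2" using K[of "axis 1 1" "axis 6 1"] s k by (simp add: axis_def field_simps)
  have e14: "v$2 * w$5 = v$5 * w$2" using K[of "axis 1 1" "axis 4 1"] s k by (simp add: axis_def field_simps)
  have e15: "v$2 * w$4 = v$4 * w$2" using K[of "axis 1 1" "axis 5 1"] s k by (simp add: axis_def field_simps)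
  have f23: "v$1 * w$6 = v$6 * w$1" using K[of "axis 2 1" "axis 3 1"] s k by (simp add: axis_def field_simps)
  have f26: "v$1 * w$3 = v$3 * w$1" using K[of "axis 2 1" "axis 6 1"] s k by (simp add: axis_def field_simps)
  have f24: "v$1 * w$5 = v$5 * w$1" using K[of "axis 2 1" "axis 4 1"] s k by (simp add: axis_def field_simps)
  have f25: "v$1 * w$4 = v$4 * w$1" using K[of "axis 2 1" "axis 5 1"] s k by (simp add: axis_def field_simps)
  have "v $ 2 = 0"
  proof (rule ccontr)
    assume "v $ 2 \<noteq> 0"
    then have "w = (w $ 2 / v $ 2) *\<^sub>R v"
      using e e13 e16 e14 e15 by (simp add: vec_eq_iff forall_6 field_simps)
    then show False using indep by blast
  qed
  moreover have "w $ 2 = 0"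
  proof (rule ccontr)
    assume "w $ 2 \<noteq> 0"
    then have "v = (v $ 2 / w $ 2) *\<^sub>R w"
      using e e13 e16 e14 e15 by (simp add: vec_eq_iff forall_6 field_simps)
    then show False using indep by blast
  qed
  moreover have "v $ 1 = 0"
  proof (rule ccontr)
    assume "v $ 1 \<noteq> 0"
    then have "w = (w $ 1 / v $ 1) *\<^sub>R v"
      using e f23 f26 f24 f25 by (simp add: vec_eq_iff forall_6 field_simps)
    then show False using indep by blast
  qed
  moreover have "w $ 1 = 0"
  proof (rule ccontr)
    assume "w $ 1 \<noteq> 0"
    then have "v = (v $ 1 / w $ 1) *\<^sub>R w"
      using e f23 f26 f24 f25 by (simp add: vec_eq_iff forall_6 field_simps)
    then show False using indep by blast
  qed
  ultimately show ?thesis by simp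
qed

text \<open>The distribution is spanned by pairs of basis vectors annihilating \<open>d_eta\<close>.
  Invariance up to the factor \<open>e\<close> passes this on to their images, and
  \<open>d_eta_kernel_pair\<close> puts those back into the distribution.\<close>

lemma multisymplectic_diffeo_leaf_direction:
  assumes f: "\<And>t. t > 0 \<Longrightarrow> f t = t" and \<phi>: "\<phi> \<in> multisymplectic_diffeos 3 M_pos (omega f)"
    and x: "x \<in> M_pos" and v: "v $ 1 = 0" "v $ 2 = 0"
  shows "frechet_derivative \<phi> (at x) v $ 1 = 0 \<and> frechet_derivative \<phi> (at x) v $ 2 = 0"
proof -
  let ?J = "frechet_derivative \<phi> (at x)"
  have d: "diffeomorphism M_pos M_pos \<phi>" and pb: "\<And>x. x \<in> M_pos \<Longrightarrow> form_eq 3 (pullback \<phi> (omega f) x) (omega f x)"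
    using \<phi> by (auto simp: multisymplectic_diffeos_def)
  have C2: "Ck_on 2 M_pos \<phi>" using d by (simp add: diffeomorphism_def smooth_on_def)
  have maps: "\<phi> y \<in> M_pos" if "y \<in> M_pos" for y
    using d that by (auto simp: diffeomorphism_def bij_betw_def)
  have om: "omega_split (sqrt (\<phi> y $ 2)) (map (frechet_derivative \<phi> (at y)) [u, v, w]) = omega_split (sqrt (y $ 2)) [u, v, w]"
    if "y \<in> M_pos" for y u v w
    using pb[OF that, unfolded form_eq_def, rule_format, of "[u, v, w]"]
    by (simp add: pullback_def linear_pullback_def omega_M_pos[OF f that] omega_M_pos[OF f maps[OF that]])
  have J: "linear ?J"
    using C2 x has_derivative_linear by (simp add: numeral_2_eq_2 frechet_derivative_works) blast
  have bij: "bij ?J"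
    using om[OF x] by (intro omega_split_pullback_bij[OF J]) simp
  have pos: "\<phi> x $ 2 > 0" "x $ 2 > 0" using x maps by (auto simp: M_pos_def)
  obtain e where e: "\<And>vs. length vs = 4 \<Longrightarrow>
       d_eta (sqrt (\<phi> x $ 2)) (\<lambda>h. h $ 2 / (2 * sqrt (\<phi> x $ 2))) (map ?J vs)
       = e * d_eta (sqrt (x $ 2)) (\<lambda>h. h $ 2 / (2 * sqrt (x $ 2))) vs"
  proof (rule d_eta_pullback_of_omega[OF open_M_pos x C2, where \<sigma> = "\<lambda>y. sqrt (y $ 2)" and \<tau> = "\<lambda>y. sqrt (y $ 2)"])
    show "sqrt (\<phi> y $ 2) \<noteq> 0" "sqrt (y $ 2) \<noteq> 0" if "y \<in> M_pos" for y
      using that maps[OF that] by (auto simp: M_pos_def)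
  qed (use has_derivative_sqrt_coord pos om in auto)
  \<comment> \<open>\<open>d\<eta>\<close> contains neither \<open>dx\<^sup>3\<^sup>4\<close> nor \<open>dx\<^sup>5\<^sup>6\<close>, so it vanishes on the pairs used here.\<close>
  have pair: "?J (axis i 1) $ 1 = 0 \<and> ?J (axis i 1) $ 2 = 0 \<and> ?J (axis j 1) $ 1 = 0 \<and> ?J (axis j 1) $ 2 = 0"
    if ij: "(i, j) = (3, 4) \<or> (i, j) = (5, 6)" for i j
  proof (rule d_eta_kernel_pair)
    show "sqrt (\<phi> x $ 2) > 0" "1 / (2 * sqrt (\<phi> x $ 2)) \<noteq> 0" using pos by auto
    show "d_eta (sqrt (\<phi> x $ 2)) (\<lambda>h. 1 / (2 * sqrt (\<phi> x $ 2)) * h $ 2) [?J (axis i 1), ?J (axis j 1), a, b] = 0" for a b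
    proof -
      \<comment> \<open>Arbitrary \<open>a\<close>, \<open>b\<close> are images under the bijection,
        which reduces the claim to vanishing at \<open>x\<close>.\<close>
      obtain a' b' where "a = ?J a'" "b = ?J b'" using bij by (metis bij_pointE)
      moreover have "d_eta s (\<lambda>h. h $ 2 / k) [axis i 1, axis j 1, a', b'] = 0" for s k
        using ij by (auto simp: d_eta_def eta_split'_def dx_3 axis_def)
      ultimately show ?thesis
        using e[of "[axis i 1, axis j 1, a', b']"] by simp
    qed
    have "i \<noteq> j" using ij by auto
    have "axis i 1 \<noteq> c *\<^sub>R (axis j 1 :: real ^ 6)" "axis j 1 \<noteq> c *\<^sub>R (axis i 1 :: real ^ 6)" for c
      using \<open>i \<noteq> j\<close> by (auto simp: vec_eq_iff axis_def)
    then show "?J (axis i 1) \<noteq> c *\<^sub>R ?J (axis j 1)" "?J (axis j 1) \<noteq> c *\<^sub>R ?J (axis i 1)" for c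
      using bij by (metis bij_is_inj injD linear_scale[OF J])+
  qed
  have "v = v$3 *\<^sub>R axis 3 1 + v$4 *\<^sub>R axis 4 1 + v$5 *\<^sub>R axis 5 1 + v$6 *\<^sub>R axis 6 1"
    using v by (simp add: vec_eq_iff forall_6 axis_def)
  then have "?J v = v$3 *\<^sub>R ?J (axis 3 1) + v$4 *\<^sub>R ?J (axis 4 1) + v$5 *\<^sub>R ?J (axis 5 1) + v$6 *\<^sub>R ?J (axis 6 1)"
    using linear_add[OF J] linear_scale[OF J] by metis
  then show ?thesis using pair[of 3 4] pair[of 5 6] by simp
qed

text \<open>The straight path from \<open>x\<close> through \<open>y\<close> keeps its second
  coordinate and so stays in the half space; its velocity lies in the distribution, so the first
  coordinate of \<open>\<phi>\<close> is constant along it.\<close>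

lemma multisymplectic_diffeo_leaf:
  assumes f: "\<And>t. t > 0 \<Longrightarrow> f t = t" and \<phi>: "\<phi> \<in> multisymplectic_diffeos 3 M_pos (omega f)"
    and x: "x \<in> M_pos" and xy: "x $ 1 = y $ 1" "x $ 2 = y $ 2"
  shows "\<phi> x $ 1 = \<phi> y $ 1"
proof -
  define g where "g = (\<lambda>t. \<phi> (x + t *\<^sub>R (y - x)) $ 1)"
  have d: "diffeomorphism M_pos M_pos \<phi>" using \<phi> by (auto simp: multisymplectic_diffeos_def)
  have C2: "Ck_on 2 M_pos \<phi>" using d by (simp add: diffeomorphism_def smooth_on_def)
  have "(g has_real_derivative 0) (at t)" for t
  proof -
    let ?z = "x + t *\<^sub>R (y - x)"
    have z: "?z \<in> M_pos" using x xy by (simp add: M_pos_def)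
    have 1: "(\<phi> has_derivative frechet_derivative \<phi> (at ?z)) (at ?z)"
      using C2 z by (simp add: numeral_2_eq_2 frechet_derivative_works)
    have 2: "((\<lambda>t. x + t *\<^sub>R (y - x)) has_derivative (\<lambda>h. h *\<^sub>R (y - x))) (at t)"
      by (auto intro!: derivative_eq_intros)
    have "frechet_derivative \<phi> (at ?z) (h *\<^sub>R (y - x)) $ 1 = 0" for h
      using multisymplectic_diffeo_leaf_direction[OF f \<phi> z] xy by simp
    with has_derivative_vec_nth_comp[OF has_derivative_compose[OF 2 1], of 1] show ?thesis
      by (simp add: g_def has_field_derivative_def lambda_zero)
  qed
  then have "g 0 = g 1" by (intro DERIV_isconst_all) blast
  then show ?thesis by (simp add: g_def)
qed

lemma not_transitive_2_omega:
  assumes f: "\<And>t. t > 0 \<Longrightarrow> f t = t"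
  shows "\<not> k_transitive 2 (multisymplectic_diffeos 3 M_pos (omega f)) (\<lambda>\<phi> x. \<phi> x) M_pos"
proof
  assume tr: "k_transitive 2 (multisymplectic_diffeos 3 M_pos (omega f)) (\<lambda>\<phi> x. \<phi> x) M_pos"
  \<comment> \<open>\<open>p\<close> and \<open>q\<close> share a leaf while \<open>p\<close> and
    \<open>r\<close> do not, so the pair \<open>p\<close>, \<open>q\<close> cannot be sent to
    \<open>p\<close>, \<open>r\<close>.\<close>
  define p q r :: "real ^ 6" where "p = axis 2 1" and "q = axis 2 1 + axis 3 1" and "r = axis 2 1 + axis 1 1"
  have *: "p \<in> M_pos" "q \<in> M_pos" "r \<in> M_pos" "p \<noteq> q" "p \<noteq> r" "p $ 1 = q $ 1" "p $ 2 = q $ 2" "p $ 1 \<noteq> r $ 1"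
    by (auto simp: p_def q_def r_def M_pos_def axis_def vec_eq_iff)
  obtain \<phi> where "\<phi> \<in> multisymplectic_diffeos 3 M_pos (omega f)" and "\<forall>i<2. \<phi> ([p, q] ! i) = [p, r] ! i"
    using tr[unfolded k_transitive_def, rule_format, of "[p, q]" "[p, r]"] * by auto
  moreover from this have "\<phi> p = p" "\<phi> q = r" by (auto simp: less_2_cases_iff)
  ultimately show False using multisymplectic_diffeo_leaf[OF f _ *(1,6,7)] *(8) by metis
qed

theorem proposition5p14:
  fixes f :: "real \<Rightarrow> real"
  assumes f_id: "\<And>t. t > 0 \<Longrightarrow> f t = t"
  shows "multisymplectic 2 M_pos (omega f) \<and>
    constant_linear_type 3 M_pos (omega f) \<and>
    \<not> flat 3 M_pos (omega f) \<and>
    k_transitive 1 (multisymplectic_diffeos 3 M_pos (omega f)) (\<lambda>\<phi> x. \<phi> x) M_pos \<and>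
    \<not> k_transitive 2 (multisymplectic_diffeos 3 M_pos (omega f)) (\<lambda>\<phi> x. \<phi> x) M_pos"
  using multisymplectic_omega constant_linear_type_omega not_flat_omega transitive_1_omega
    not_transitive_2_omega f_id by blast

end
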